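(* There is an absolute constant $c>0$ such that for every $\alpha\in(0,1)$, every deterministic algorithm for single-machine non-clairvoyant scheduling with a single untrusted signal that is $(1+\alpha)$-consistent has robustness at least $1+c\sqrt{1/\alpha}$, i.e., there are instances (with arbitrary $\beta_j$) on which its ratio $\mathrm{ALG}/\mathrm{OPT}$ is at least $1+c\sqrt{1/\alpha}$.
   Context: Single-machine preemptive scheduling of $n$ jobs available at time $0$ with unknown processing times $p_j>0$, minimizing the total completion time $\sum_j C_j$ (where $C_j$ is when job $j$ has received $p_j$ units of processing); the machine's capacity can be shared arbitrarily among unfinished jobs. Each job $j$ emits a signal when its elapsed processing reaches $\beta_jp_j$ for an unknown $\beta_j\in[0,1]$; $\alpha$ is known. An algorithm is $c$-consistent if $\mathrm{ALG}\le c\,\mathrm{OPT}$ on all instances with $\beta_j=\alpha$ for all $j$, and has robustness $r$ if $\mathrm{ALG}\le r\,\mathrm{OPT}$ on all instances with arbitrary $\beta_j\in[0,1]$. The statement in the paper is written as robustness $1+\Omega(\sqrt{1/\alpha})$. *)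

theory Defs
  imports Complex_Main
begin

(* Jobs are 0, ..., n-1.  A schedule e is given by elapsed processing: e j t is the amount of
   processing that job j has received by time t >= 0. *)
type_synonym schedule = "nat \<Rightarrow> real \<Rightarrow> real"

(* The first argument is the number of jobs, the second the processing times p, the third the
   signal parameters beta.  What an algorithm may use of p and beta is restricted in
   non_anticipating. *)
type_synonym algorithm = "nat \<Rightarrow> (nat \<Rightarrow> real) \<Rightarrow> (nat \<Rightarrow> real) \<Rightarrow> schedule"

definition valid_instance :: "nat \<Rightarrow> (nat \<Rightarrow> real) \<Rightarrow> (nat \<Rightarrow> real) \<Rightarrow> bool" where
  "valid_instance n p \<beta> \<longleftrightarrow> n \<ge> 1 \<and> (\<forall>j<n. p j > 0 \<and> 0 \<le> \<beta> j \<and> \<beta> j \<le> 1)"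

(* The third conjunct is the unit capacity, shared arbitrarily: together with monotonicity it makes
   each e j Lipschitz, so that e j is the integral of rates that are nonnegative and sum to at most
   1 (idling is allowed).  The last two say that finished jobs receive no further processing and
   that every job is eventually finished. *)
definition feasible_schedule :: "nat \<Rightarrow> (nat \<Rightarrow> real) \<Rightarrow> schedule \<Rightarrow> bool" where
  "feasible_schedule n p e \<longleftrightarrow>
     (\<forall>j<n. e j 0 = 0) \<and>
     (\<forall>j<n. \<forall>s t. 0 \<le> s \<and> s \<le> t \<longrightarrow> e j s \<le> e j t) \<and>
     (\<forall>s t. 0 \<le> s \<and> s \<le> t \<longrightarrow> (\<Sum>j<n. e j t - e j s) \<le> t - s) \<and>
     (\<forall>j<n. \<forall>t\<ge>0. e j t \<le> p j) \<and>
     (\<forall>j<n. \<exists>t\<ge>0. e j t = p j)"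

definition completion_time :: "(nat \<Rightarrow> real) \<Rightarrow> schedule \<Rightarrow> nat \<Rightarrow> real" where
  "completion_time p e j = Inf {t. 0 \<le> t \<and> p j \<le> e j t}"

definition total_completion_time :: "nat \<Rightarrow> (nat \<Rightarrow> real) \<Rightarrow> schedule \<Rightarrow> real" where
  "total_completion_time n p e = (\<Sum>j<n. completion_time p e j)"

definition OPT :: "nat \<Rightarrow> (nat \<Rightarrow> real) \<Rightarrow> real" where
  "OPT n p = Inf {total_completion_time n p e | e. feasible_schedule n p e}"

definition signalled :: "(nat \<Rightarrow> real) \<Rightarrow> (nat \<Rightarrow> real) \<Rightarrow> schedule \<Rightarrow> real \<Rightarrow> nat \<Rightarrow> bool" where
  "signalled p \<beta> e t j \<longleftrightarrow> \<beta> j * p j \<le> e j t"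

definition finished :: "(nat \<Rightarrow> real) \<Rightarrow> schedule \<Rightarrow> real \<Rightarrow> nat \<Rightarrow> bool" where
  "finished p e t j \<longleftrightarrow> p j \<le> e j t"

(* An online algorithm learns n at the start, and afterwards only which jobs have emitted their
   signal and which are finished.  So on two instances that are indistinguishable before time T it
   has to produce the same schedule up to time T.  The observations at time T itself, which
   may already differ, can only influence what happens after T. *)
definition non_anticipating :: "algorithm \<Rightarrow> bool" where
  "non_anticipating A \<longleftrightarrow>
     (\<forall>n p \<beta> p' \<beta>' T.
        valid_instance n p \<beta> \<and> valid_instance n p' \<beta>' \<and>
        (\<forall>t. 0 \<le> t \<and> t < T \<longrightarrow> (\<forall>j<n.
            (signalled p \<beta> (A n p \<beta>) t j \<longleftrightarrow> signalled p' \<beta>' (A n p' \<beta>') t j) \<and>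
            (finished p (A n p \<beta>) t j \<longleftrightarrow> finished p' (A n p' \<beta>') t j))) \<longrightarrow>
        (\<forall>t. 0 \<le> t \<and> t \<le> T \<longrightarrow> (\<forall>j<n. A n p \<beta> j t = A n p' \<beta>' j t)))"

definition deterministic_algorithm :: "algorithm \<Rightarrow> bool" where
  "deterministic_algorithm A \<longleftrightarrow>
     (\<forall>n p \<beta>. valid_instance n p \<beta> \<longrightarrow> feasible_schedule n p (A n p \<beta>)) \<and>
     non_anticipating A"

definition ALG :: "algorithm \<Rightarrow> nat \<Rightarrow> (nat \<Rightarrow> real) \<Rightarrow> (nat \<Rightarrow> real) \<Rightarrow> real" where
  "ALG A n p \<beta> = total_completion_time n p (A n p \<beta>)"

definition consistent :: "real \<Rightarrow> algorithm \<Rightarrow> real \<Rightarrow> bool" where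
  "consistent \<alpha> A c \<longleftrightarrow>
     (\<forall>n p \<beta>. valid_instance n p \<beta> \<and> (\<forall>j<n. \<beta> j = \<alpha>) \<longrightarrow> ALG A n p \<beta> \<le> c * OPT n p)"

definition robust :: "algorithm \<Rightarrow> real \<Rightarrow> bool" where
  "robust A r \<longleftrightarrow> (\<forall>n p \<beta>. valid_instance n p \<beta> \<longrightarrow> ALG A n p \<beta> \<le> r * OPT n p)"

end

theory Submission
  imports Defs
begin

text \<open>
  Run the algorithm on \<open>n\<close> unit jobs with correct signals, and let \<open>x\<^sub>j\<close> be the processing that
  job \<open>j\<close> has received when the first job finishes.  Processing spent on unfinished jobs delays
  completions, so if the jobs are listed in decreasing order of completion time, the excess of ALG
  over OPT is at least the sum of all proper prefix sums of \<open>x\<close>; consistency bounds it by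
  \<open>\<alpha> n (n + 1) / 2\<close>.  Now shrink every job but the first finished one to the size \<open>x\<^sub>j + \<alpha>\<close>,
  leaving the signals where they were.  The algorithm cannot notice this before the first job has
  finished, so it pays at least \<open>n\<close>, whereas processing the jobs in the above order costs, by the
  same prefix sums, only \<open>1 + O(\<alpha> n\<^sup>2)\<close>.  Taking \<open>n\<close> close to \<open>1 / sqrt \<alpha>\<close> gives the bound for
  small \<open>\<alpha>\<close>.  When \<open>\<alpha>\<close> is bounded away from 0, the same construction with two jobs and
  useless signals bounds the ratio of every algorithm away from 1.
\<close>

section \<open>Schedules\<close>

lemma feasible_schedule_mono:
  assumes "feasible_schedule n p e" "j < n" "0 \<le> s" "s \<le> t"
  shows "e j s \<le> e j t"
  using assms unfolding feasible_schedule_def by blast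

text \<open>The increments of the other jobs are nonnegative, so the capacity bound for the sum
  bounds each single increment.\<close>

lemma feasible_schedule_lipschitz:
  assumes "feasible_schedule n p e" "j < n" "0 \<le> s" "s \<le> t"
  shows "e j t \<le> e j s + (t - s)"
proof -
  have "e j t - e j s \<le> (\<Sum>j<n. e j t - e j s)"
    using assms by (intro member_le_sum) (auto simp: feasible_schedule_def)
  also have "\<dots> \<le> t - s"
    using assms by (auto simp: feasible_schedule_def)
  finally show ?thesis by simp
qed

lemma feasible_schedule_capacity:
  assumes "feasible_schedule n p e" "0 \<le> t"
  shows "(\<Sum>j<n. e j t) \<le> t"
proof -
  have "(\<Sum>j<n. e j t) = (\<Sum>j<n. e j t - e j 0)"
    using assms by (intro sum.cong) (auto simp: feasible_schedule_def)
  also have "\<dots> \<le> t - 0"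
    using assms unfolding feasible_schedule_def by blast
  finally show ?thesis by simp
qed

text \<open>The infimum defining \<open>completion_time\<close> is attained: by the Lipschitz bound,
  a job lacking an amount \<open>d\<close> at time \<open>t\<close> needs at least until
  \<open>t + d\<close>.\<close>

lemma completion_time_le_iff:
  assumes e: "feasible_schedule n p e" and j: "j < n" and t: "0 \<le> t"
  shows "completion_time p e j \<le> t \<longleftrightarrow> p j \<le> e j t"
proof
  let ?S = "{t. 0 \<le> t \<and> p j \<le> e j t}"
  have bdd: "bdd_below ?S" by (auto intro: bdd_belowI[of _ 0])
  show "completion_time p e j \<le> t" if "p j \<le> e j t"
    unfolding completion_time_def using that t bdd by (intro cInf_lower) auto
  show "p j \<le> e j t" if le: "completion_time p e j \<le> t"
  proof (rule ccontr)
    assume "\<not> p j \<le> e j t"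
    define d where "d = p j - e j t"
    have d: "d > 0" using \<open>\<not> p j \<le> e j t\<close> by (simp add: d_def)
    have "?S \<noteq> {}"
      using e j unfolding feasible_schedule_def by (metis (mono_tags, lifting) empty_Collect_eq order_refl)
    moreover have "t + d \<le> s" if "s \<in> ?S" for s
    proof (cases "s \<le> t")
      case True
      then have "e j s \<le> e j t" using that e j by (auto simp: feasible_schedule_def)
      with that d show ?thesis by (auto simp: d_def)
    next
      case False
      then show ?thesis
        using feasible_schedule_lipschitz[OF e j t, of s] that by (auto simp: d_def)
    qed
    ultimately have "t + d \<le> completion_time p e j"
      unfolding completion_time_def by (intro cInf_greatest)
    with le d show False by simp
  qed
qed

lemma completion_time_nonneg:
  assumes "feasible_schedule n p e" "j < n"
  shows "0 \<le> completion_time p e j"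
  unfolding completion_time_def
proof (rule cInf_greatest)
  show "{t. 0 \<le> t \<and> p j \<le> e j t} \<noteq> {}"
    using assms unfolding feasible_schedule_def
    by (metis (mono_tags, lifting) empty_Collect_eq order_refl)
qed auto

lemma elapsed_at_completion_time:
  assumes "feasible_schedule n p e" "j < n" "completion_time p e j \<le> t"
  shows "e j t = p j"
proof -
  have "0 \<le> t" using completion_time_nonneg[OF assms(1,2)] assms(3) by linarith
  then show ?thesis
    using completion_time_le_iff[OF assms(1,2)] assms
    unfolding feasible_schedule_def by (metis order_antisym)
qed

lemma completion_time_ge_size:
  assumes "feasible_schedule n p e" "j < n"
  shows "p j \<le> completion_time p e j"
  using feasible_schedule_lipschitz[OF assms, of 0 "completion_time p e j"]
    elapsed_at_completion_time[OF assms order_refl] completion_time_nonneg[OF assms] assms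
  by (simp add: feasible_schedule_def)

section \<open>The optimum\<close>

text \<open>Work done by time \<open>t\<close> on the job in position \<open>k\<close> when jobs of
  sizes \<open>q 0, q 1, ...\<close> run one after another without idling.\<close>

definition clamp_work :: "(nat \<Rightarrow> real) \<Rightarrow> nat \<Rightarrow> real \<Rightarrow> real" where
  "clamp_work q k t = max 0 (min (t - (\<Sum>l<k. q l)) (q k))"

text \<open>This yields the unit capacity of sequential schedules, since the right-hand side grows
  at rate at most 1 in \<open>t\<close>.\<close>

lemma sum_clamp_work:
  assumes "\<And>k. k < n \<Longrightarrow> 0 \<le> q k" "0 \<le> t"
  shows "(\<Sum>k<n. clamp_work q k t) = min t (\<Sum>k<n. q k)"
  using assms
proof (induction n)
  case (Suc n)
  then have "(\<Sum>k<n. clamp_work q k t) = min t (\<Sum>k<n. q k)" "0 \<le> q n"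
    by simp_all
  then show ?case by (simp add: clamp_work_def min_def max_def)
qed simp

lemma sequential_schedule_exists:
  assumes \<sigma>: "bij_betw \<sigma> {..<n} {..<n}" and p: "\<And>j. j < n \<Longrightarrow> 0 < p j"
  shows "\<exists>e. feasible_schedule n p e \<and>
     total_completion_time n p e \<le> (\<Sum>k<n. \<Sum>l\<le>k. p (\<sigma> l))"
proof -
  define \<tau> where "\<tau> = inv_into {..<n} \<sigma>"
  define q where "q = p \<circ> \<sigma>"
  define e where "e j t = clamp_work q (\<tau> j) t" for j t
  have \<sigma>_less: "\<sigma> k < n" if "k < n" for k
    using \<sigma> that by (auto simp: bij_betw_def)
  have \<tau>\<sigma>: "\<tau> (\<sigma> k) = k" if "k < n" for k
    using \<sigma> that unfolding \<tau>_def by (intro inv_into_f_f) (auto simp: bij_betw_def)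
  have \<sigma>\<tau>: "\<sigma> (\<tau> j) = j" if "j < n" for j
    using \<sigma> that unfolding \<tau>_def by (intro f_inv_into_f) (auto simp: bij_betw_def)
  have \<tau>_less: "\<tau> j < n" if "j < n" for j
    using \<sigma> that unfolding \<tau>_def by (metis bij_betw_def inv_into_into lessThan_iff)
  have q: "0 < q k" if "k < n" for k
    using p \<sigma>_less that by (simp add: q_def)
  have prefix: "0 \<le> (\<Sum>l<k. q l)" if "k < n" for k
    using q that by (intro sum_nonneg less_imp_le) auto
  have q\<tau>: "q (\<tau> j) = p j" if "j < n" for j
    using \<sigma>\<tau> that by (simp add: q_def)
  have total: "(\<Sum>j<n. e j t) = min t (\<Sum>k<n. q k)" if "0 \<le> t" for t
  proof -
    have "(\<Sum>j<n. e j t) = (\<Sum>k<n. e (\<sigma> k) t)"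
      by (rule sum.reindex_bij_betw[OF \<sigma>, symmetric])
    also have "\<dots> = (\<Sum>k<n. clamp_work q k t)"
      by (intro sum.cong) (auto simp: e_def \<tau>\<sigma>)
    finally show ?thesis using sum_clamp_work[of n q t] q that by (simp add: less_imp_le)
  qed
  have done_at: "e j ((\<Sum>l<\<tau> j. q l) + q (\<tau> j)) = p j" if "j < n" for j
    using that p[of j] by (simp add: e_def clamp_work_def q\<tau>)
  have e: "feasible_schedule n p e"
    unfolding feasible_schedule_def
  proof (intro conjI allI impI)
    fix j assume j: "j < n"
    show "e j 0 = 0" using prefix[OF \<tau>_less[OF j]] by (simp add: e_def clamp_work_def)
    show "e j s \<le> e j t" if "0 \<le> s \<and> s \<le> t" for s t
      using that by (auto simp: e_def clamp_work_def)
    show "e j t \<le> p j" for t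
      using q\<tau>[OF j] p[OF j] by (auto simp: e_def clamp_work_def)
    show "\<exists>t\<ge>0. e j t = p j"
      using done_at[OF j] prefix[OF \<tau>_less[OF j]] q[OF \<tau>_less[OF j]]
      by (metis add_nonneg_nonneg less_imp_le)
  next
    fix s t :: real assume "0 \<le> s \<and> s \<le> t"
    then show "(\<Sum>j<n. e j t - e j s) \<le> t - s"
      using total[of s] total[of t] by (simp add: sum_subtractf min_def)
  qed
  have "total_completion_time n p e \<le> (\<Sum>k<n. \<Sum>l\<le>k. p (\<sigma> l))"
  proof -
    have "total_completion_time n p e = (\<Sum>k<n. completion_time p e (\<sigma> k))"
      unfolding total_completion_time_def by (rule sum.reindex_bij_betw[OF \<sigma>, symmetric])
    also have "\<dots> \<le> (\<Sum>k<n. \<Sum>l\<le>k. p (\<sigma> l))"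
    proof (rule sum_mono)
      fix k assume "k \<in> {..<n}"
      then have k: "k < n" by simp
      have "completion_time p e (\<sigma> k) \<le> (\<Sum>l<k. q l) + q k"
        using completion_time_le_iff[OF e \<sigma>_less[OF k]] done_at[OF \<sigma>_less[OF k]]
          prefix[OF k] q[OF k] by (simp add: \<tau>\<sigma> k)
      also have "\<dots> = (\<Sum>l\<le>k. p (\<sigma> l))"
        by (simp add: q_def flip: lessThan_Suc_atMost)
      finally show "completion_time p e (\<sigma> k) \<le> (\<Sum>l\<le>k. p (\<sigma> l))" .
    qed
    finally show ?thesis .
  qed
  with e show ?thesis by blast
qed

text \<open>An upper bound from one explicit order suffices: the adversary only has to show that the
  optimum is small.\<close>

lemma OPT_le_sequential:
  assumes \<sigma>: "bij_betw \<sigma> {..<n} {..<n}" and p: "\<And>j. j < n \<Longrightarrow> 0 < p j"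
  shows "OPT n p \<le> (\<Sum>k<n. \<Sum>l\<le>k. p (\<sigma> l))"
proof -
  obtain e where e: "feasible_schedule n p e"
    and le: "total_completion_time n p e \<le> (\<Sum>k<n. \<Sum>l\<le>k. p (\<sigma> l))"
    using sequential_schedule_exists[of \<sigma> n p] assms by blast
  have "OPT n p \<le> total_completion_time n p e"
    unfolding OPT_def
  proof (rule cInf_lower)
    show "bdd_below {total_completion_time n p e |e. feasible_schedule n p e}"
      by (rule bdd_belowI[of _ 0])
        (auto simp: total_completion_time_def intro!: sum_nonneg completion_time_nonneg)
  qed (use e in blast)
  with le show ?thesis by simp
qed

text \<open>No job completes before its own size has elapsed, so every schedule costs at least the
  total size. Positivity permits passing to ratios.\<close>

lemma OPT_pos:
  assumes "valid_instance n p \<beta>"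
  shows "0 < OPT n p"
proof -
  have p: "\<And>j. j < n \<Longrightarrow> 0 < p j" and n: "n \<ge> 1"
    using assms by (auto simp: valid_instance_def)
  have "(\<Sum>j<n. p j) \<le> OPT n p"
    unfolding OPT_def
  proof (rule cInf_greatest)
    show "{total_completion_time n p e |e. feasible_schedule n p e} \<noteq> {}"
      using sequential_schedule_exists[of id n p] p by auto
  next
    fix c assume "c \<in> {total_completion_time n p e |e. feasible_schedule n p e}"
    then show "(\<Sum>j<n. p j) \<le> c"
      by (auto simp: total_completion_time_def intro!: sum_mono completion_time_ge_size)
  qed
  moreover have "0 < (\<Sum>j<n. p j)"
    using p n by (intro sum_pos) (auto simp: lessThan_empty_iff)
  ultimately show ?thesis by simp
qed

section \<open>The adversary\<close>

text \<open>
  \<^const>\<open>non_anticipating\<close> presupposes that the observations agree along both schedules, so the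
  agreement has to be propagated in time: as thresholds are inclusive and schedules are
  continuous, agreement up to \<open>s\<close> always extends a little beyond \<open>s\<close>.
\<close>

lemma indistinguishable_schedules:
  assumes A: "deterministic_algorithm A"
    and v: "valid_instance n p \<beta>" and v': "valid_instance n p' \<beta>'"
    and sig: "\<And>j. j < n \<Longrightarrow> \<beta> j * p j = \<beta>' j * p' j"
    and unfinished: "\<And>j t. j < n \<Longrightarrow> 0 \<le> t \<Longrightarrow> t < T \<Longrightarrow> A n p \<beta> j t < p j \<and> A n p \<beta> j t < p' j"
    and t: "0 \<le> t" "t \<le> T" and j: "j < n"
  shows "A n p \<beta> j t = A n p' \<beta>' j t"
proof -
  define e e' where "e = A n p \<beta>" and "e' = A n p' \<beta>'"
  have fe: "feasible_schedule n p e" and fe': "feasible_schedule n p' e'"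
    using A v v' by (auto simp: deterministic_algorithm_def e_def e'_def)
  have na: "\<forall>t. 0 \<le> t \<and> t \<le> S \<longrightarrow> (\<forall>j<n. e j t = e' j t)"
    if "\<And>t j. 0 \<le> t \<Longrightarrow> t < S \<Longrightarrow> j < n \<Longrightarrow>
          (signalled p \<beta> e t j \<longleftrightarrow> signalled p' \<beta>' e' t j) \<and>
          (finished p e t j \<longleftrightarrow> finished p' e' t j)" for S
    using A v v' that unfolding deterministic_algorithm_def non_anticipating_def e_def e'_def
    by blast
  define S where "S = {s. 0 \<le> s \<and> s \<le> T \<and> (\<forall>t. 0 \<le> t \<and> t \<le> s \<longrightarrow> (\<forall>j<n. e j t = e' j t))}"
  have "0 \<in> S"
    using fe fe' t by (auto simp: S_def feasible_schedule_def dest: order_antisym)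
  have bdd: "bdd_above S" by (auto simp: S_def intro: bdd_aboveI[of _ T])
  define s where "s = Sup S"
  have s: "0 \<le> s" "s \<le> T"
    unfolding s_def using \<open>0 \<in> S\<close> bdd
    by (auto intro: cSup_upper cSup_least simp: S_def)
  have agree: "e j t = e' j t" if "0 \<le> t" "t < s" "j < n" for t j
  proof -
    have "S \<noteq> {}" using \<open>0 \<in> S\<close> by blast
    then obtain u where "u \<in> S" "t < u"
      using less_cSupD[of S t] \<open>t < s\<close> unfolding s_def by metis
    with that show ?thesis by (auto simp: S_def)
  qed
  \<comment> \<open>Observations strictly before \<open>s\<close> determine the schedule up to and
    including \<open>s\<close>, so the supremum belongs to \<open>S\<close>.\<close>
  have agree_s: "\<forall>t. 0 \<le> t \<and> t \<le> s \<longrightarrow> (\<forall>j<n. e j t = e' j t)"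
  proof (rule na)
    fix t j assume tj: "0 \<le> t" "t < s" "j < n"
    with unfinished[of j t] s have "e j t < p j" "e j t < p' j"
      by (auto simp: e_def)
    with agree[OF tj] sig[OF \<open>j < n\<close>]
    show "(signalled p \<beta> e t j \<longleftrightarrow> signalled p' \<beta>' e' t j) \<and>
          (finished p e t j \<longleftrightarrow> finished p' e' t j)"
      by (auto simp: signalled_def finished_def)
  qed
  have "s = T"
  proof (rule ccontr)
    assume "s \<noteq> T"
    with s have sT: "s < T" by simp
    \<comment> \<open>Growth of job \<open>j\<close> by less than \<open>f j\<close> after
      \<open>s\<close> triggers neither completion nor a new signal. If the signal is already out,
      it stays out, and the value 1 is an arbitrary positive default.\<close>
    define f where "f j = min (min (p j - e j s) (p' j - e j s))
      (if e j s < \<beta> j * p j then \<beta> j * p j - e j s else 1)" for j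
    define d where "d = Min (insert (T - s) (f ` {..<n}))"
    have f: "0 < f j" if "j < n" for j
      using unfinished[OF that s(1) sT] by (auto simp: f_def e_def)
    have d: "0 < d" "d \<le> T - s" "\<And>j. j < n \<Longrightarrow> d \<le> f j"
      using f sT by (auto simp: d_def)
    have "\<forall>t. 0 \<le> t \<and> t \<le> s + d \<longrightarrow> (\<forall>j<n. e j t = e' j t)"
    proof (rule na)
      fix t j assume tj: "0 \<le> t" "t < s + d" "j < n"
      show "(signalled p \<beta> e t j \<longleftrightarrow> signalled p' \<beta>' e' t j) \<and>
          (finished p e t j \<longleftrightarrow> finished p' e' t j)"
      proof (cases "t \<le> s")
        case True
        with tj unfinished[of j t] sT have "e j t < p j" "e j t < p' j"
          by (auto simp: e_def)
        with agree_s True tj sig[OF \<open>j < n\<close>] show ?thesis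
          by (auto simp: signalled_def finished_def)
      next
        case False
        then have st: "s \<le> t" by simp
        have eq: "e' j s = e j s" using agree_s s tj by simp
        have up: "e j t < e j s + f j" "e' j t < e j s + f j"
          using feasible_schedule_lipschitz[OF fe \<open>j < n\<close> s(1) st]
            feasible_schedule_lipschitz[OF fe' \<open>j < n\<close> s(1) st] eq d(3)[OF \<open>j < n\<close>] tj
          by linarith+
        have lo: "e j s \<le> e j t" "e j s \<le> e' j t"
          using feasible_schedule_mono[OF fe \<open>j < n\<close> s(1) st]
            feasible_schedule_mono[OF fe' \<open>j < n\<close> s(1) st] eq by simp_all
        show ?thesis
          using up lo sig[OF \<open>j < n\<close>]
          by (auto simp: signalled_def finished_def f_def split: if_splits)
      qed
    qed
    then have "s + d \<in> S" using s d by (auto simp: S_def)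
    then have "s + d \<le> s" unfolding s_def using bdd by (intro cSup_upper)
    with d show False by simp
  qed
  then show ?thesis using agree_s t j by (auto simp: e_def e'_def)
qed

text \<open>Applied to completion times, this puts the job that finishes first in the last
  position.\<close>

lemma decreasing_enumeration:
  fixes f :: "nat \<Rightarrow> real"
  obtains \<sigma> where "bij_betw \<sigma> {..<n} {..<n}" "\<And>k l. k \<le> l \<Longrightarrow> l < n \<Longrightarrow> f (\<sigma> l) \<le> f (\<sigma> k)"
proof
  define xs where "xs = sort_key (\<lambda>j. - f j) [0..<n]"
  have len: "length xs = n" and dist: "distinct xs" and set: "set xs = {..<n}"
    by (auto simp: xs_def)
  show "bij_betw ((!) xs) {..<n} {..<n}"
    using bij_betw_nth[OF dist] len set by simp
  have "sorted (map (\<lambda>j. - f j) xs)" by (simp add: xs_def)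
  then show "f (xs ! l) \<le> f (xs ! k)" if "k \<le> l" "l < n" for k l
    using sorted_nth_mono[of "map (\<lambda>j. - f j) xs" k l] that len by simp
qed

text \<open>
  The job \<open>\<sigma> m\<close> is the first one to finish when all \<open>m + 1\<close> jobs have unit size and signal at
  \<open>\<theta>\<close>; \<open>x\<close> records the elapsed processing at that moment.
\<close>

lemma adversary:
  assumes A: "deterministic_algorithm A" and \<theta>: "0 \<le> \<theta>" "\<theta> \<le> 1"
  obtains \<sigma> x where
    "bij_betw \<sigma> {..<Suc m} {..<Suc m}"
    "\<And>j. j < Suc m \<Longrightarrow> 0 \<le> x j"
    "(\<Sum>k<Suc m. real (Suc k)) + (\<Sum>k<Suc m. \<Sum>l<k. x (\<sigma> l))
       \<le> ALG A (Suc m) (\<lambda>_. 1) (\<lambda>_. \<theta>)"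
    "\<And>p. \<lbrakk>p (\<sigma> m) = 1; \<And>k. k < m \<Longrightarrow> x (\<sigma> k) < p (\<sigma> k) \<and> \<theta> \<le> p (\<sigma> k)\<rbrakk> \<Longrightarrow>
       valid_instance (Suc m) p (\<lambda>j. \<theta> / p j) \<and>
       real (Suc m) \<le> ALG A (Suc m) p (\<lambda>j. \<theta> / p j)"
proof -
  define n where "n = Suc m"
  define p1 :: "nat \<Rightarrow> real" where "p1 = (\<lambda>_. 1)"
  define \<beta>1 :: "nat \<Rightarrow> real" where "\<beta>1 = (\<lambda>_. \<theta>)"
  define e where "e = A n p1 \<beta>1"
  define C where "C = completion_time p1 e"
  have v: "valid_instance n p1 \<beta>1"
    using \<theta> by (simp add: valid_instance_def n_def p1_def \<beta>1_def)
  have e: "feasible_schedule n p1 e"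
    using A v by (auto simp: deterministic_algorithm_def e_def)
  obtain \<sigma> where \<sigma>: "bij_betw \<sigma> {..<n} {..<n}"
    and mono: "\<And>k l. k \<le> l \<Longrightarrow> l < n \<Longrightarrow> C (\<sigma> l) \<le> C (\<sigma> k)"
    using decreasing_enumeration[of n C] by blast
  have \<sigma>_less: "\<sigma> k < n" if "k < n" for k
    using \<sigma> that by (auto simp: bij_betw_def)
  have \<sigma>_surj: "\<exists>k<n. j = \<sigma> k" if "j < n" for j
    using \<sigma> that unfolding bij_betw_def by (metis imageE lessThan_iff)
  define T where "T = C (\<sigma> m)"
  define x where "x j = e j T" for j
  have T_le: "T \<le> C j" if "j < n" for j
  proof -
    obtain k where "k < n" "j = \<sigma> k"
      using \<sigma>_surj[OF \<open>j < n\<close>] by blast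
    then show ?thesis using mono[of k m] by (simp add: T_def n_def)
  qed
  have T: "1 \<le> T"
    using completion_time_ge_size[OF e, of "\<sigma> m"] \<sigma>_less[of m]
    by (simp add: n_def T_def C_def p1_def)
  have x_nonneg: "0 \<le> x j" if "j < n" for j
  proof -
    have "e j 0 \<le> e j T" "e j 0 = 0"
      using feasible_schedule_mono[OF e that, of 0 T] e that T
      by (auto simp: feasible_schedule_def)
    then show ?thesis by (simp add: x_def)
  qed
  \<comment> \<open>By time \<open>C (\<sigma> k)\<close> the jobs in positions
    \<open>k, ..., n - 1\<close> have received one unit each, and every earlier position at least
    what it had at time \<open>T\<close>. Capacity bounds the total by the elapsed time.\<close>
  have C_ge: "real (n - k) + (\<Sum>l<k. x (\<sigma> l)) \<le> C (\<sigma> k)" if k: "k < n" for k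
  proof -
    let ?t = "C (\<sigma> k)"
    have t: "0 \<le> ?t" using completion_time_nonneg[OF e \<sigma>_less[OF k]] by (simp add: C_def)
    have "(\<Sum>l<n. e (\<sigma> l) ?t) = (\<Sum>l<k. e (\<sigma> l) ?t) + (\<Sum>l\<in>{k..<n}. e (\<sigma> l) ?t)"
      using k by (subst sum.union_disjoint[symmetric]) (auto simp: ivl_disj_un)
    moreover have "(\<Sum>l\<in>{k..<n}. e (\<sigma> l) ?t) = (\<Sum>l\<in>{k..<n}. 1)"
    proof (rule sum.cong)
      fix l assume "l \<in> {k..<n}"
      then show "e (\<sigma> l) ?t = 1"
        using elapsed_at_completion_time[OF e \<sigma>_less, of l ?t] mono[of k l]
        by (simp add: C_def p1_def)
    qed simp
    moreover have "(\<Sum>l<k. x (\<sigma> l)) \<le> (\<Sum>l<k. e (\<sigma> l) ?t)"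
    proof (rule sum_mono)
      fix l assume "l \<in> {..<k}"
      then have "\<sigma> l < n" using \<sigma>_less k by simp
      then show "x (\<sigma> l) \<le> e (\<sigma> l) ?t"
        using feasible_schedule_mono[OF e, of "\<sigma> l" T ?t] T_le[OF \<sigma>_less[OF k]] T
        by (simp add: x_def)
    qed
    moreover have "(\<Sum>l<n. e (\<sigma> l) ?t) \<le> ?t"
      using feasible_schedule_capacity[OF e t] sum.reindex_bij_betw[OF \<sigma>, of "\<lambda>j. e j ?t"]
      by simp
    ultimately show ?thesis by simp
  qed
  have "(\<Sum>k<n. real (Suc k)) = (\<Sum>k<n. real (n - k))"
    by (subst sum.nat_diff_reindex[symmetric]) (auto intro!: sum.cong)
  then have "(\<Sum>k<n. real (Suc k)) + (\<Sum>k<n. \<Sum>l<k. x (\<sigma> l))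
      = (\<Sum>k<n. real (n - k) + (\<Sum>l<k. x (\<sigma> l)))"
    by (simp add: sum.distrib)
  also have "\<dots> \<le> (\<Sum>k<n. C (\<sigma> k))"
    using C_ge by (intro sum_mono) auto
  also have "\<dots> = ALG A n p1 \<beta>1"
    unfolding ALG_def total_completion_time_def e_def[symmetric] C_def[symmetric]
    by (rule sum.reindex_bij_betw[OF \<sigma>])
  finally have cost: "(\<Sum>k<n. real (Suc k)) + (\<Sum>k<n. \<Sum>l<k. x (\<sigma> l)) \<le> ALG A n p1 \<beta>1" .
  have shrunk: "valid_instance n p (\<lambda>j. \<theta> / p j) \<and> real n \<le> ALG A n p (\<lambda>j. \<theta> / p j)"
    if pm: "p (\<sigma> m) = 1" and pk: "\<And>k. k < m \<Longrightarrow> x (\<sigma> k) < p (\<sigma> k) \<and> \<theta> \<le> p (\<sigma> k)" for p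
  proof
    have cases: "j = \<sigma> m \<or> x j < p j \<and> \<theta> \<le> p j" if "j < n" for j
    proof -
      obtain k where "k < n" "j = \<sigma> k"
        using \<sigma>_surj[OF \<open>j < n\<close>] by blast
      then show ?thesis using pk[of k] by (cases "k = m") (auto simp: n_def)
    qed
    have p: "0 < p j \<and> \<theta> \<le> p j" if "j < n" for j
      using cases[OF that] x_nonneg[OF that] pm \<theta> by auto
    \<comment> \<open>Dividing by \<open>p j\<close> keeps the signal at absolute position
      \<open>\<theta>\<close>; \<open>\<theta> \<le> p j\<close> makes the parameter at most
      1.\<close>
    show v': "valid_instance n p (\<lambda>j. \<theta> / p j)"
      using p \<theta> unfolding valid_instance_def by (simp add: n_def less_imp_le)
    define e' where "e' = A n p (\<lambda>j. \<theta> / p j)"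
    have e': "feasible_schedule n p e'"
      using A v' by (auto simp: deterministic_algorithm_def e'_def)
    have unfinished: "e j t < p1 j \<and> e j t < p j" if "j < n" "0 \<le> t" "t < T" for j t
    proof -
      have "e j t < p1 j"
        using completion_time_le_iff[OF e that(1,2)] T_le[OF that(1)] that by (auto simp: C_def)
      moreover have "e j t \<le> x j"
        using feasible_schedule_mono[OF e that(1,2), of T] that by (simp add: x_def)
      ultimately show ?thesis using cases[OF that(1)] pm by (auto simp: p1_def)
    qed
    have same: "e j t = e' j t" if "0 \<le> t" "t \<le> T" "j < n" for t j
      unfolding e_def e'_def
    proof (rule indistinguishable_schedules[OF A v v' _ _ that])
      show "\<beta>1 j * p1 j = \<theta> / p j * p j" if "j < n" for j
        using p[OF that] by (simp add: \<beta>1_def p1_def)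
    qed (use unfinished in \<open>auto simp: e_def\<close>)
    \<comment> \<open>Up to \<open>T\<close> the shrunk run copies the unit run, in which no job has
      reached its old or new size before \<open>T\<close>; and \<open>T\<close> is at least
      1.\<close>
    have "1 \<le> completion_time p e' j" if "j < n" for j
    proof (rule ccontr)
      define t where "t = completion_time p e' j"
      assume "\<not> ?thesis"
      with T have "t < T" by (simp add: t_def)
      moreover have "0 \<le> t" using completion_time_nonneg[OF e' that] by (simp add: t_def)
      ultimately show False
        using unfinished[OF that, of t] same[of t j]
          elapsed_at_completion_time[OF e' that, of t] that by (simp add: t_def)
    qed
    then have "(\<Sum>j<n. 1) \<le> ALG A n p (\<lambda>j. \<theta> / p j)"
      unfolding ALG_def total_completion_time_def e'_def[symmetric] by (intro sum_mono) auto
    then show "real n \<le> ALG A n p (\<lambda>j. \<theta> / p j)" by simp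
  qed
  show thesis
    by (rule that[of \<sigma> x])
      (use \<sigma> x_nonneg cost shrunk in \<open>auto simp only: n_def p1_def \<beta>1_def\<close>)
qed

section \<open>Bad instances obtained from the adversary\<close>

lemma sum_Suc_real: "(\<Sum>k<n. real (Suc k)) = real n * (real n + 1) / 2"
  by (induction n) (auto simp: field_simps)

lemma OPT_unit_jobs: "OPT n (\<lambda>_. 1) \<le> real n * (real n + 1) / 2"
  using OPT_le_sequential[of id n "\<lambda>_. 1"] sum_Suc_real[of n] by simp

lemma consistent_imp_bad_instance:
  assumes A: "deterministic_algorithm A" and cons: "consistent \<alpha> A (1 + \<alpha>)"
    and \<alpha>: "0 < \<alpha>" "\<alpha> < 1"
  obtains p \<beta> where "valid_instance (Suc m) p \<beta>" "real (Suc m) \<le> ALG A (Suc m) p \<beta>"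
    "OPT (Suc m) p \<le> 1 + 3 * \<alpha> * (real (Suc m))\<^sup>2"
proof -
  define n where "n = Suc m"
  obtain \<sigma> x where \<sigma>: "bij_betw \<sigma> {..<n} {..<n}"
    and x: "\<And>j. j < n \<Longrightarrow> 0 \<le> x j"
    and cost: "(\<Sum>k<n. real (Suc k)) + (\<Sum>k<n. \<Sum>l<k. x (\<sigma> l)) \<le> ALG A n (\<lambda>_. 1) (\<lambda>_. \<alpha>)"
    and shrunk: "\<And>p. \<lbrakk>p (\<sigma> m) = 1; \<And>k. k < m \<Longrightarrow> x (\<sigma> k) < p (\<sigma> k) \<and> \<alpha> \<le> p (\<sigma> k)\<rbrakk> \<Longrightarrow>
       valid_instance n p (\<lambda>j. \<alpha> / p j) \<and> real n \<le> ALG A n p (\<lambda>j. \<alpha> / p j)"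
    using adversary[OF A, of \<alpha> m] \<alpha> unfolding n_def by (metis less_imp_le)
  define W where "W = (\<Sum>k<n. \<Sum>l<k. x (\<sigma> l))"
  define H where "H = real n * (real n + 1) / 2"
  have x\<sigma>: "0 \<le> x (\<sigma> k)" if "k < n" for k
    using \<sigma> that by (intro x) (auto simp: bij_betw_def)
  have "valid_instance n (\<lambda>_. 1) (\<lambda>_. \<alpha>)"
    using \<alpha> by (simp add: valid_instance_def n_def)
  then have "ALG A n (\<lambda>_. 1) (\<lambda>_. \<alpha>) \<le> (1 + \<alpha>) * OPT n (\<lambda>_. 1)"
    using cons unfolding consistent_def by blast
  also have "\<dots> \<le> (1 + \<alpha>) * H"
    using OPT_unit_jobs[of n] \<alpha> by (intro mult_left_mono) (auto simp: H_def)
  \<comment> \<open>The unit run costs at least \<open>H + W\<close>, and consistency allows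
    \<open>(1 + \<alpha>) * H\<close>.\<close>
  finally have W: "W \<le> \<alpha> * H"
    using cost sum_Suc_real[of n] by (simp add: W_def H_def algebra_simps)
  \<comment> \<open>The size \<open>x j + \<alpha>\<close> exceeds the work \<open>x j\<close>
    already done and leaves room for the signal at \<open>\<alpha>\<close>.\<close>
  define p where "p j = (if j = \<sigma> m then 1 else x j + \<alpha>)" for j
  have p\<sigma>: "p (\<sigma> k) = x (\<sigma> k) + \<alpha>" if "k < m" for k
    using \<sigma> that by (auto simp: p_def n_def bij_betw_def dest!: inj_onD)
  have pm: "p (\<sigma> m) = 1" by (simp add: p_def)
  have bad: "valid_instance n p (\<lambda>j. \<alpha> / p j) \<and> real n \<le> ALG A n p (\<lambda>j. \<alpha> / p j)"
  proof (rule shrunk[of p, OF pm])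
    show "x (\<sigma> k) < p (\<sigma> k) \<and> \<alpha> \<le> p (\<sigma> k)" if "k < m" for k
      using p\<sigma>[OF that] x\<sigma>[of k] \<alpha> that by (simp add: n_def)
  qed
  have prefix: "(\<Sum>l<k. p (\<sigma> l)) = (\<Sum>l<k. x (\<sigma> l)) + \<alpha> * real k" if "k \<le> m" for k
  proof -
    have "(\<Sum>l<k. p (\<sigma> l)) = (\<Sum>l<k. x (\<sigma> l) + \<alpha>)"
      using p\<sigma> that by (intro sum.cong) auto
    then show ?thesis by (simp add: sum.distrib)
  qed
  have "OPT n p \<le> (\<Sum>k<n. \<Sum>l\<le>k. p (\<sigma> l))"
    using bad by (intro OPT_le_sequential[OF \<sigma>]) (auto simp: valid_instance_def)
  also have "\<dots> = (\<Sum>k<m. \<Sum>l<Suc k. p (\<sigma> l)) + ((\<Sum>l<m. p (\<sigma> l)) + 1)"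
    by (simp add: n_def pm flip: lessThan_Suc_atMost)
  also have "(\<Sum>k<m. \<Sum>l<Suc k. p (\<sigma> l)) = (\<Sum>k<m. (\<Sum>l<Suc k. x (\<sigma> l)) + \<alpha> * real (Suc k))"
    by (intro sum.cong prefix refl) auto
  \<comment> \<open>The shift of the index is harmless because the empty prefix contributes 0 to
    \<open>W\<close>.\<close>
  also have "\<dots> = W + \<alpha> * (real m * (real m + 1) / 2)"
    unfolding W_def n_def sum.lessThan_Suc_shift[of _ m] sum.distrib sum_distrib_left[symmetric]
      sum_Suc_real by simp
  also have "(\<Sum>l<m. p (\<sigma> l)) = (\<Sum>l<m. x (\<sigma> l)) + \<alpha> * real m"
    by (rule prefix) simp
  finally have "OPT n p \<le> W + (\<Sum>l<m. x (\<sigma> l)) + \<alpha> * (real m * (real m + 1) / 2 + real m) + 1"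
    by (simp add: algebra_simps)
  \<comment> \<open>The longest prefix sum is one of the nonnegative summands of \<open>W\<close>.
    Hence \<open>W\<close> enters the bound at most twice, and the added \<open>\<alpha>\<close>
    terms cost at most another \<open>\<alpha> * H\<close>.\<close>
  moreover have "(\<Sum>l<m. x (\<sigma> l)) \<le> W"
    unfolding W_def using x\<sigma>
    by (intro member_le_sum[where f = "\<lambda>k. \<Sum>l<k. x (\<sigma> l)"]) (auto intro!: sum_nonneg simp: n_def)
  moreover have "\<alpha> * (real m * (real m + 1) / 2 + real m) \<le> \<alpha> * H"
    using \<alpha> by (intro mult_left_mono) (auto simp: H_def n_def field_simps)
  moreover have "\<alpha> * H \<le> \<alpha> * (real n)\<^sup>2"
    using \<alpha> by (intro mult_left_mono) (auto simp: H_def n_def power2_eq_square field_simps)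
  ultimately have "OPT n p \<le> 1 + 3 * \<alpha> * (real n)\<^sup>2"
    using W by simp
  with bad show thesis using that by (auto simp: n_def)
qed

text \<open>With \<open>\<theta> = 0\<close> all signals come at time 0 and carry no information.
  Whether the unfinished job has received 1/4 when the first one finishes decides between ratio (3 +
  1/4) / 3 = 13/12 on unit jobs and 2 / (3/2) = 4/3 after shrinking that job to 1/4.\<close>

lemma nonclairvoyant_bad_instance:
  assumes A: "deterministic_algorithm A"
  obtains n p \<beta> where "valid_instance n p \<beta>" "13 / 12 * OPT n p \<le> ALG A n p \<beta>"
proof -
  obtain \<sigma> x where \<sigma>: "bij_betw \<sigma> {..<Suc 1} {..<Suc 1}"
    and x: "\<And>j. j < Suc 1 \<Longrightarrow> (0::real) \<le> x j"
    and cost: "(\<Sum>k<Suc 1. real (Suc k)) + (\<Sum>k<Suc 1. \<Sum>l<k. x (\<sigma> l))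
       \<le> ALG A (Suc 1) (\<lambda>_. 1) (\<lambda>_. 0)"
    and shrunk: "\<And>p. \<lbrakk>p (\<sigma> 1) = 1; \<And>k. k < 1 \<Longrightarrow> x (\<sigma> k) < p (\<sigma> k) \<and> 0 \<le> p (\<sigma> k)\<rbrakk> \<Longrightarrow>
       valid_instance (Suc 1) p (\<lambda>j. 0 / p j) \<and> real (Suc 1) \<le> ALG A (Suc 1) p (\<lambda>j. 0 / p j)"
    using adversary[OF A, of 0 1] by (metis order_refl zero_le_one)
  show thesis
  proof (cases "x (\<sigma> 0) < 1 / 4")
    case False
    have "OPT (Suc 1) (\<lambda>_. 1) \<le> 3" using OPT_unit_jobs[of "Suc 1"] by simp
    moreover have "3 + 1 / 4 \<le> ALG A (Suc 1) (\<lambda>_. 1) (\<lambda>_. 0)"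
      using cost False by simp
    moreover have "valid_instance (Suc 1) (\<lambda>_. 1) (\<lambda>_. 0)"
      by (simp add: valid_instance_def)
    ultimately show thesis using that by force
  next
    case True
    define p where "p j = (if j = \<sigma> 1 then 1 else 1 / 4 :: real)" for j
    have "\<sigma> 0 \<noteq> \<sigma> 1" using \<sigma> by (auto simp: bij_betw_def dest!: inj_onD)
    then have p: "p (\<sigma> 0) = 1 / 4" "p (\<sigma> 1) = 1" by (auto simp: p_def)
    have "valid_instance (Suc 1) p (\<lambda>j. 0 / p j) \<and> real (Suc 1) \<le> ALG A (Suc 1) p (\<lambda>j. 0 / p j)"
      using p True by (intro shrunk) auto
    moreover have "OPT (Suc 1) p \<le> 3 / 2"
    proof -
      have "OPT (Suc 1) p \<le> (\<Sum>k<Suc 1. \<Sum>l\<le>k. p (\<sigma> l))"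
        by (rule OPT_le_sequential[OF \<sigma>]) (simp add: p_def)
      then show ?thesis using p by simp
    qed
    ultimately show thesis using that by force
  qed
qed

theorem theorem3:
  "\<exists>c::real. c > 0 \<and>
     (\<forall>\<alpha> A. 0 < \<alpha> \<and> \<alpha> < 1 \<and> deterministic_algorithm A \<and> consistent \<alpha> A (1 + \<alpha>) \<longrightarrow>
        (\<forall>r. robust A r \<longrightarrow> r \<ge> 1 + c * sqrt (1 / \<alpha>)) \<and>
        (\<exists>n p \<beta>. valid_instance n p \<beta> \<and> ALG A n p \<beta> / OPT n p \<ge> 1 + c * sqrt (1 / \<alpha>)))"
proof (intro exI[of _ "1 / 192"] conjI allI impI)
  fix \<alpha> :: real and A
  assume asm: "0 < \<alpha> \<and> \<alpha> < 1 \<and> deterministic_algorithm A \<and> consistent \<alpha> A (1 + \<alpha>)"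
  define q where "q = sqrt (1 / \<alpha>)"
  have q: "1 < q" and \<alpha>q: "\<alpha> * q\<^sup>2 = 1"
    using asm by (simp_all add: q_def real_sqrt_gt_1_iff)
  have bad: "\<exists>n p \<beta>. valid_instance n p \<beta> \<and> (1 + 1 / 192 * q) * OPT n p \<le> ALG A n p \<beta>"
  \<comment> \<open>The constant 1/192 is chosen so that \<open>1 + q / 192\<close> equals 13/12 at
    the threshold \<open>q = 16\<close>.\<close>
  proof (cases "q \<le> 16")
    case True
    obtain n p \<beta> where I: "valid_instance n p \<beta>" "13 / 12 * OPT n p \<le> ALG A n p \<beta>"
      using nonclairvoyant_bad_instance asm by blast
    have "(1 + 1 / 192 * q) * OPT n p \<le> 13 / 12 * OPT n p"
      using OPT_pos[OF I(1)] True by (intro mult_right_mono) auto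
    with I show ?thesis by (meson order_trans)
  next
    case False
    \<comment> \<open>The number of jobs \<open>Suc m\<close> is the integer part of
      \<open>q\<close>, so \<open>\<alpha> * (Suc m)^2\<close> is at most 1 and the optimum at most
      4, while the algorithm pays more than \<open>q - 1\<close>.\<close>
    define m where "m = nat \<lfloor>q\<rfloor> - 1"
    have m: "real (Suc m) \<le> q" "q < real (Suc m) + 1"
      using q unfolding m_def by linarith+
    obtain p \<beta> where I: "valid_instance (Suc m) p \<beta>" "real (Suc m) \<le> ALG A (Suc m) p \<beta>"
      "OPT (Suc m) p \<le> 1 + 3 * \<alpha> * (real (Suc m))\<^sup>2"
      using consistent_imp_bad_instance asm by blast
    have "\<alpha> * (real (Suc m))\<^sup>2 \<le> \<alpha> * q\<^sup>2"
      using asm m by (intro mult_left_mono power_mono) auto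
    with I \<alpha>q have "OPT (Suc m) p \<le> 4" by simp
    then have "(1 + 1 / 192 * q) * OPT (Suc m) p \<le> (1 + 1 / 192 * q) * 4"
      using q by (intro mult_left_mono) auto
    also have "\<dots> \<le> real (Suc m)" using m False by simp
    finally show ?thesis using I by (meson order_trans)
  qed
  then obtain n p \<beta> where I: "valid_instance n p \<beta>"
    "(1 + 1 / 192 * q) * OPT n p \<le> ALG A n p \<beta>" by blast
  from I show "\<exists>n p \<beta>. valid_instance n p \<beta> \<and> ALG A n p \<beta> / OPT n p \<ge> 1 + 1 / 192 * sqrt (1 / \<alpha>)"
    using OPT_pos[OF I(1)] unfolding q_def[symmetric] by (metis pos_le_divide_eq)
  fix r assume "robust A r"
  with I have "(1 + 1 / 192 * q) * OPT n p \<le> r * OPT n p"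
    unfolding robust_def by (meson order_trans)
  with OPT_pos[OF I(1)] show "r \<ge> 1 + 1 / 192 * sqrt (1 / \<alpha>)"
    by (simp add: q_def)
qed simp

end
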